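(* For all integers $k\ge3$ and $n\ge2$, the number $\phi(k,n;T,L)$ of $k\times n$ $(0,1)$-matrices avoiding $\{T,L\}$, where $T=\begin{pmatrix}1&1\\0&0\end{pmatrix}$ and $L=\begin{pmatrix}1&0\\1&0\end{pmatrix}$, is equal to twice the number of rook positions in the $k\times n$ chessboard; in other words, $$\phi(k,n;T,L)=2\sum_{m=0}^{\min(k,n)}\binom{k}{m}\binom{n}{m}m!.$$
   Context: A $(0,1)$-matrix is a matrix with all entries in $\{0,1\}$. A $2\times2$ submatrix of a matrix is obtained by choosing two rows $i_1<i_2$ and two columns $j_1<j_2$. For a $2\times2$ $(0,1)$-matrix $P$, let $[P]$ be its equivalence class under row exchanges and column exchanges. Here $[T]=\left\{\begin{pmatrix}1&1\\0&0\end{pmatrix},\begin{pmatrix}0&0\\1&1\end{pmatrix}\right\}$ and $[L]=\left\{\begin{pmatrix}1&0\\1&0\end{pmatrix},\begin{pmatrix}0&1\\0&1\end{pmatrix}\right\}$. A $(0,1)$-matrix avoids $\{T,L\}$ if none of its $2\times2$ submatrices belongs to $[T]\cup[L]$, and $\phi(k,n;T,L)$ is the number of such $k\times n$ matrices. A rook position in the $k\times n$ chessboard is a placement of any number $m\ge0$ of (indistinguishable) pairwise non-attacking rooks, i.e. a set of cells with no two in the same row or column. *)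

theory Defs
  imports Jordan_Normal_Form.Column_Operations Jordan_Normal_Form.DL_Submatrix
begin

definition zero_one_mats :: "nat \<Rightarrow> nat \<Rightarrow> nat mat set" where
  "zero_one_mats k n = {A \<in> carrier_mat k n. elements_mat A \<subseteq> {0, 1}}"

inductive_set exchange_class :: "'a mat \<Rightarrow> 'a mat set" for P :: "'a mat" where
  base: "P \<in> exchange_class P"
| rows: "\<lbrakk>Q \<in> exchange_class P; i < dim_row Q; j < dim_row Q\<rbrakk>
    \<Longrightarrow> swaprows i j Q \<in> exchange_class P"
| cols: "\<lbrakk>Q \<in> exchange_class P; i < dim_col Q; j < dim_col Q\<rbrakk>
    \<Longrightarrow> swapcols i j Q \<in> exchange_class P"

text \<open>The library's \<^const>\<open>submatrix\<close> keeps the rows indexed by \<open>I\<close> and the columns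
  indexed by \<open>J\<close>, in increasing order.\<close>

definition avoids :: "'a mat \<Rightarrow> 'a mat set \<Rightarrow> bool" where
  "avoids A F \<longleftrightarrow>
    (\<forall>I J. I \<subseteq> {..<dim_row A} \<longrightarrow> card I = 2 \<longrightarrow> J \<subseteq> {..<dim_col A} \<longrightarrow> card J = 2 \<longrightarrow>
      (\<forall>P\<in>F. submatrix A I J \<notin> exchange_class P))"

definition phi :: "nat \<Rightarrow> nat \<Rightarrow> nat mat set \<Rightarrow> nat" where
  "phi k n F = card {A \<in> zero_one_mats k n. avoids A F}"

definition T_mat :: "nat mat" where
  "T_mat = mat_of_rows_list 2 [[1, 1], [0, 0]]"

definition L_mat :: "nat mat" where
  "L_mat = mat_of_rows_list 2 [[1, 0], [1, 0]]"

definition rook_positions :: "nat \<Rightarrow> nat \<Rightarrow> (nat \<times> nat) set set" where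
  "rook_positions k n = {R. R \<subseteq> {..<k} \<times> {..<n} \<and>
    (\<forall>c\<in>R. \<forall>d\<in>R. c \<noteq> d \<longrightarrow> fst c \<noteq> fst d \<and> snd c \<noteq> snd d)}"

lemma finite_zero_one_mats: "finite (zero_one_mats k n)"
proof (rule finite_subset)
  show "zero_one_mats k n
    \<subseteq> (\<lambda>S. mat k n (\<lambda>c. if c \<in> S then 1 else 0)) ` Pow ({..<k} \<times> {..<n})"
  proof
    fix A assume "A \<in> zero_one_mats k n"
    then have A: "A \<in> carrier_mat k n" and e: "elements_mat A \<subseteq> {0, 1}"
      by (auto simp: zero_one_mats_def)
    have 01: "A $$ (i, j) = 0 \<or> A $$ (i, j) = 1" if "i < k" "j < n" for i j
      using e elements_matI[OF A that] by blast
    have "A = mat k n (\<lambda>c. if c \<in> {c \<in> {..<k} \<times> {..<n}. A $$ c = 1} then 1 else 0)"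
      using A 01 by (intro eq_matI) auto
    then show "A \<in> (\<lambda>S. mat k n (\<lambda>c. if c \<in> S then 1 else 0)) ` Pow ({..<k} \<times> {..<n})"
      by blast
  qed
qed auto

lemma mat_2_eq_iff:
  assumes "dim_row A = 2" "dim_col A = 2" "dim_row B = 2" "dim_col B = 2"
  shows "A = B \<longleftrightarrow> A $$ (0, 0) = B $$ (0, 0) \<and> A $$ (0, 1) = B $$ (0, 1) \<and>
    A $$ (1, 0) = B $$ (1, 0) \<and> A $$ (1, 1) = B $$ (1, 1)"
  using assms by (auto simp: mat_eq_iff less_2_cases_iff)

lemma exchange_class_T:
  "exchange_class T_mat = {T_mat, mat_of_rows_list 2 [[0, 0], [1, 1]]}" (is "_ = {_, ?T'}")
proof
  have sr: "swaprows i j T_mat \<in> {T_mat, ?T'}" "swaprows i j ?T' \<in> {T_mat, ?T'}"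
    if "i < 2" "j < 2" for i j
    using that by (auto simp: T_mat_def mat_of_rows_list_def less_2_cases_iff mat_2_eq_iff)
  have sc: "swapcols i j T_mat = T_mat" "swapcols i j ?T' = ?T'" if "i < 2" "j < 2" for i j
    using that by (auto simp: T_mat_def mat_of_rows_list_def less_2_cases_iff mat_2_eq_iff)
  have dims: "dim_row T_mat = 2" "dim_col T_mat = 2" "dim_row ?T' = 2" "dim_col ?T' = 2"
    by (simp_all add: T_mat_def mat_of_rows_list_def)
  show "exchange_class T_mat \<subseteq> {T_mat, ?T'}"
  proof
    fix Q assume "Q \<in> exchange_class T_mat"
    then show "Q \<in> {T_mat, ?T'}"
    proof induction
      case (rows Q i j)
      then have "i < 2" "j < 2" using dims by auto
      then show ?case using sr[of i j] rows.IH by blast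
    next
      case (cols Q i j)
      then have "i < 2" "j < 2" using dims by auto
      then show ?case using sc[of i j] cols.IH by blast
    qed simp
  qed
  have "swaprows 0 1 T_mat = ?T'"
    by (auto simp: T_mat_def mat_of_rows_list_def less_2_cases_iff mat_2_eq_iff)
  then show "{T_mat, ?T'} \<subseteq> exchange_class T_mat"
    using exchange_class.base[of T_mat]
      exchange_class.rows[OF exchange_class.base, of 0 T_mat 1] dims by auto
qed

lemma exchange_class_L:
  "exchange_class L_mat = {L_mat, mat_of_rows_list 2 [[0, 1], [0, 1]]}" (is "_ = {_, ?L'}")
proof
  have sc: "swapcols i j L_mat \<in> {L_mat, ?L'}" "swapcols i j ?L' \<in> {L_mat, ?L'}"
    if "i < 2" "j < 2" for i j
    using that by (auto simp: L_mat_def mat_of_rows_list_def less_2_cases_iff mat_2_eq_iff)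
  have sr: "swaprows i j L_mat = L_mat" "swaprows i j ?L' = ?L'" if "i < 2" "j < 2" for i j
    using that by (auto simp: L_mat_def mat_of_rows_list_def less_2_cases_iff mat_2_eq_iff)
  have dims: "dim_row L_mat = 2" "dim_col L_mat = 2" "dim_row ?L' = 2" "dim_col ?L' = 2"
    by (simp_all add: L_mat_def mat_of_rows_list_def)
  show "exchange_class L_mat \<subseteq> {L_mat, ?L'}"
  proof
    fix Q assume "Q \<in> exchange_class L_mat"
    then show "Q \<in> {L_mat, ?L'}"
    proof induction
      case (rows Q i j)
      then have "i < 2" "j < 2" using dims by auto
      then show ?case using sr[of i j] rows.IH by blast
    next
      case (cols Q i j)
      then have "i < 2" "j < 2" using dims by auto
      then show ?case using sc[of i j] cols.IH by blast
    qed simp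
  qed
  have "swapcols 0 1 L_mat = ?L'"
    by (auto simp: L_mat_def mat_of_rows_list_def less_2_cases_iff mat_2_eq_iff)
  then show "{L_mat, ?L'} \<subseteq> exchange_class L_mat"
    using exchange_class.base[of L_mat]
      exchange_class.cols[OF exchange_class.base, of 0 L_mat 1] dims by auto
qed

end

theory Submission
  imports Defs
begin

text \<open>
  Identify a matrix with the set \<open>S\<close> of cells carrying a one. Exchanging zeros and ones maps
  \<open>[T]\<close> to itself and \<open>[L]\<close> to itself, so \<open>S\<close> avoids \<open>{T, L}\<close> exactly when its complement
  does. Every rook position avoids: both classes need two ones in a line. The heart of the matter
  is that for \<open>k \<ge> 3\<close> and \<open>n \<ge> 2\<close> nothing else occurs: \<open>S\<close> or its complement is a rook position
  (\<open>line_avoiding_iff\<close>).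

  To see this, look at two columns. Two rows reading \<open>10\<close> there would form a member of \<open>[L]\<close>, and
  so would two rows reading \<open>01\<close>; hence among three rows one reads \<open>00\<close> or \<open>11\<close>. By
  complementation suppose it reads \<open>00\<close>. Then no row reads \<open>11\<close> in these columns, because of
  \<open>[T]\<close>, and so each of them holds at most one one. Comparing an arbitrary column with one of
  these two spreads the bound to all columns, and a further row, then empty in two given columns, excludes two ones in
  a row (\<open>rook_position_of_empty_pair\<close>).

  No set is counted twice: in a column of height at least three, the ones and the zeros cannot
  both number at most one. This gives the factor two. The closed form comes from the recursion on
  the number of rows for rook positions with a given number of rooks
  (\<open>card_rook_positions_size\<close>).
\<close>

section \<open>Avoiding matrices as sets of cells\<close>

definition ones :: "nat mat \<Rightarrow> (nat \<times> nat) set" where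
  "ones A = {c \<in> {..<dim_row A} \<times> {..<dim_col A}. A $$ c = 1}"

text \<open>The rows \<open>i, i'\<close> and the columns \<open>j, j'\<close> are not assumed to be in increasing order: this
  way one clause covers both members of an exchange class, and the predicate is visibly
  symmetric.\<close>

definition line_avoiding :: "nat \<Rightarrow> nat \<Rightarrow> (nat \<times> nat) set \<Rightarrow> bool" where
  "line_avoiding k n S \<longleftrightarrow>
    (\<forall>i<k. \<forall>i'<k. \<forall>j<n. \<forall>j'<n. i \<noteq> i' \<longrightarrow> j \<noteq> j' \<longrightarrow>
      \<not> ((i, j) \<in> S \<and> (i, j') \<in> S \<and> (i', j) \<notin> S \<and> (i', j') \<notin> S) \<and>
      \<not> ((i, j) \<in> S \<and> (i', j) \<in> S \<and> (i, j') \<notin> S \<and> (i', j') \<notin> S))"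

lemma pick_two:
  fixes p q :: nat
  assumes "p < q"
  shows "pick {p, q} 0 = p" "pick {p, q} (Suc 0) = q"
proof -
  show p0: "pick {p, q} 0 = p"
    using assms by (auto intro!: Least_equality)
  show "pick {p, q} (Suc 0) = q"
    using assms p0 by (auto intro!: Least_equality)
qed

lemma submatrix_two:
  assumes "p < q" "q < dim_row A" "r < s" "s < dim_col A"
  shows "submatrix A {p, q} {r, s} =
    mat_of_rows_list 2 [[A $$ (p, r), A $$ (p, s)], [A $$ (q, r), A $$ (q, s)]]"
proof -
  have I: "{i. i < dim_row A \<and> i \<in> {p, q}} = {p, q}"
    and J: "{j. j < dim_col A \<and> j \<in> {r, s}} = {r, s}"
    using assms by auto
  show ?thesis
    unfolding submatrix_def I J using assms
    by (subst mat_2_eq_iff) (simp_all add: mat_of_rows_list_def pick_two del: pick.simps)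
qed

lemma mat_of_two_rows_eq_iff:
  "mat_of_rows_list 2 [[a, b], [c, d]] = mat_of_rows_list 2 [[a', b'], [c', d']] \<longleftrightarrow>
    a = a' \<and> b = b' \<and> c = c' \<and> d = d'"
  by (subst mat_2_eq_iff) (auto simp: mat_of_rows_list_def)

lemma card_2_less_obtain:
  fixes I :: "nat set"
  assumes "card I = 2"
  obtains p q where "I = {p, q}" "p < q"
  using assms unfolding card_2_iff by (metis insert_commute nat_neq_iff)

text \<open>For a submatrix with increasing rows \<open>p < q\<close> and columns \<open>r < s\<close>, the two forbidden members
  whose ones lie in row \<open>p\<close> or column \<open>r\<close> are the clauses of \<open>line_avoiding\<close> at
  \<open>(p, q, r, s)\<close>; the other two are its clauses at \<open>(q, p, s, r)\<close>. The two mixed orders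
  pair the same four configurations differently.\<close>

lemma avoids_iff_line_avoiding:
  assumes "A \<in> zero_one_mats k n"
  shows "avoids A {T_mat, L_mat} \<longleftrightarrow> line_avoiding k n (ones A)"
proof -
  have dims: "dim_row A = k" "dim_col A = n"
    and "elements_mat A \<subseteq> {0, 1}"
    using assms by (auto simp: zero_one_mats_def)
  then have zo: "A $$ (i, j) = 0 \<or> A $$ (i, j) = 1" if "i < k" "j < n" for i j
    using that by (metis carrier_matI elements_matI insert_iff singletonD subsetD)
  define ok where "ok p q r s \<longleftrightarrow>
      (\<forall>P \<in> {T_mat, L_mat}. submatrix A {p, q} {r, s} \<notin> exchange_class P)" for p q r s
  define bad where "bad i i' j j' \<longleftrightarrow>
      (i, j) \<in> ones A \<and> (i, j') \<in> ones A \<and> (i', j) \<notin> ones A \<and> (i', j') \<notin> ones A \<or>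
      (i, j) \<in> ones A \<and> (i', j) \<in> ones A \<and> (i, j') \<notin> ones A \<and> (i', j') \<notin> ones A" for i i' j j'
  have ok_bad: "ok p q r s \<longleftrightarrow> \<not> bad p q r s \<and> \<not> bad q p s r"
    if lt: "p < q" "q < k" "r < s" "s < n" for p q r s
  proof -
    have entry: "A $$ (i, j) = (if (i, j) \<in> ones A then 1 else 0)" if "i \<in> {p, q}" "j \<in> {r, s}" for i j
      using zo[of i j] that lt dims by (auto simp: ones_def)
    have sub: "submatrix A {p, q} {r, s} =
        mat_of_rows_list 2 [[A $$ (p, r), A $$ (p, s)], [A $$ (q, r), A $$ (q, s)]]"
      using lt dims by (intro submatrix_two) auto
    have "ok p q r s \<longleftrightarrow> submatrix A {p, q} {r, s} \<notin>
        {T_mat, mat_of_rows_list 2 [[0, 0], [1, 1]], L_mat, mat_of_rows_list 2 [[0, 1], [0, 1]]}"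
      by (simp add: ok_def exchange_class_T exchange_class_L)
    also have "\<dots> \<longleftrightarrow> [A $$ (p, r), A $$ (p, s), A $$ (q, r), A $$ (q, s)] \<notin>
        {[1, 1, 0, 0], [0, 0, 1, 1], [1, 0, 1, 0], [0, 1, 0, 1]}"
      unfolding sub T_mat_def L_mat_def by (simp add: mat_of_two_rows_eq_iff)
    also have "\<dots> \<longleftrightarrow> \<not> bad p q r s \<and> \<not> bad q p s r"
      unfolding bad_def
      by (cases "(p, r) \<in> ones A"; cases "(p, s) \<in> ones A"; cases "(q, r) \<in> ones A";
          cases "(q, s) \<in> ones A") (simp_all add: entry)
    finally show ?thesis .
  qed
  have "avoids A {T_mat, L_mat} \<longleftrightarrow> (\<forall>p q r s. p < q \<longrightarrow> q < k \<longrightarrow> r < s \<longrightarrow> s < n \<longrightarrow> ok p q r s)"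
    (is "_ \<longleftrightarrow> ?R")
  proof
    assume av: "avoids A {T_mat, L_mat}"
    show ?R
    proof (intro allI impI)
      fix p q r s assume "p < q" "q < k" "r < s" "s < n"
      then show "ok p q r s"
        using av[unfolded avoids_def, rule_format, of "{p, q}" "{r, s}"] dims
        by (auto simp: ok_def)
    qed
  next
    assume R: ?R
    show "avoids A {T_mat, L_mat}"
      unfolding avoids_def
    proof (intro allI impI)
      fix I J assume I: "I \<subseteq> {..<dim_row A}" "card I = 2" and J: "J \<subseteq> {..<dim_col A}" "card J = 2"
      obtain p q where "I = {p, q}" "p < q" using card_2_less_obtain[OF I(2)] .
      moreover obtain r s where "J = {r, s}" "r < s" using card_2_less_obtain[OF J(2)] .
      ultimately show "\<forall>P \<in> {T_mat, L_mat}. submatrix A I J \<notin> exchange_class P"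
        using R I(1) J(1) dims unfolding ok_def by auto
    qed
  qed
  also have "\<dots> \<longleftrightarrow>
      (\<forall>i<k. \<forall>i'<k. \<forall>j<n. \<forall>j'<n. i \<noteq> i' \<longrightarrow> j \<noteq> j' \<longrightarrow> \<not> bad i i' j j')" (is "_ \<longleftrightarrow> ?L")
  proof
    assume R: ?R
    have ordered: "\<not> bad p q r s \<and> \<not> bad q p s r" if "p < q" "q < k" "r < s" "s < n" for p q r s
      using R ok_bad that by blast
    show ?L
    proof (intro allI impI)
      fix i i' j j' assume *: "i < k" "i' < k" "j < n" "j' < n" "i \<noteq> i'" "j \<noteq> j'"
      then consider "i < i'" "j < j'" | "i < i'" "j' < j" | "i' < i" "j < j'" | "i' < i" "j' < j"
        by linarith
      then show "\<not> bad i i' j j'"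
      proof cases
        case 1 then show ?thesis using ordered[of i i' j j'] * by blast
      next
        case 2 then show ?thesis using ordered[of i i' j' j] * unfolding bad_def by blast
      next
        case 3 then show ?thesis using ordered[of i' i j j'] * unfolding bad_def by blast
      next
        case 4 then show ?thesis using ordered[of i' i j' j] * by blast
      qed
    qed
  next
    assume L: ?L
    show ?R
    proof (intro allI impI)
      fix p q r s assume lt: "p < q" "q < k" "r < s" "s < n"
      then show "ok p q r s"
        unfolding ok_bad[OF lt] using L by simp
    qed
  qed
  also have "\<dots> \<longleftrightarrow> line_avoiding k n (ones A)"
    unfolding line_avoiding_def bad_def de_Morgan_disj ..
  finally show ?thesis .
qed

lemma bij_betw_ones: "bij_betw ones (zero_one_mats k n) (Pow ({..<k} \<times> {..<n}))"
proof (rule bij_betw_byWitness)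
  let ?m = "\<lambda>S. mat k n (\<lambda>c. if c \<in> S then 1 else 0) :: nat mat"
  show "\<forall>A\<in>zero_one_mats k n. ?m (ones A) = A"
  proof
    fix A assume "A \<in> zero_one_mats k n"
    then have A: "A \<in> carrier_mat k n" and "elements_mat A \<subseteq> {0, 1}"
      by (auto simp: zero_one_mats_def)
    then have "A $$ (i, j) = 0 \<or> A $$ (i, j) = 1" if "i < k" "j < n" for i j
      using elements_matI[OF A that refl] by auto
    then show "?m (ones A) = A"
      using A by (intro eq_matI) (auto simp: ones_def)
  qed
  show "\<forall>S\<in>Pow ({..<k} \<times> {..<n}). ones (?m S) = S"
    by (auto simp: ones_def split: if_split_asm)
  show "ones ` zero_one_mats k n \<subseteq> Pow ({..<k} \<times> {..<n})"
    by (auto simp: ones_def zero_one_mats_def)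
  show "?m ` Pow ({..<k} \<times> {..<n}) \<subseteq> zero_one_mats k n"
    by (auto simp: zero_one_mats_def elements_mat_def split: if_split_asm)
qed

lemma phi_eq_card_line_avoiding:
  "phi k n {T_mat, L_mat} = card {S. S \<subseteq> {..<k} \<times> {..<n} \<and> line_avoiding k n S}"
proof -
  have "bij_betw ones {A \<in> zero_one_mats k n. avoids A {T_mat, L_mat}}
      {S \<in> Pow ({..<k} \<times> {..<n}). line_avoiding k n S}"
    by (rule bij_betw_Collect[OF bij_betw_ones]) (simp add: avoids_iff_line_avoiding)
  then show ?thesis
    by (simp add: phi_def bij_betw_same_card)
qed

section \<open>Avoiding sets are rook positions or their complements\<close>

lemma rook_positions_iff:
  "S \<in> rook_positions k n \<longleftrightarrow> S \<subseteq> {..<k} \<times> {..<n} \<and>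
    (\<forall>i j j'. (i, j) \<in> S \<longrightarrow> (i, j') \<in> S \<longrightarrow> j = j') \<and>
    (\<forall>i i' j. (i, j) \<in> S \<longrightarrow> (i', j) \<in> S \<longrightarrow> i = i')"
  unfolding rook_positions_def by (auto simp: Ball_def) blast+

text \<open>A line of ones beside a parallel line of zeros becomes the same configuration with
  the two lines exchanged.\<close>

lemma line_avoiding_complement:
  "line_avoiding k n ({..<k} \<times> {..<n} - S) \<longleftrightarrow> line_avoiding k n S"
proof -
  have flip: "line_avoiding k n U"
    if av: "line_avoiding k n V" and "\<And>i j. i < k \<Longrightarrow> j < n \<Longrightarrow> (i, j) \<in> U \<longleftrightarrow> (i, j) \<notin> V" for U V
    unfolding line_avoiding_def
  proof (intro allI impI)
    fix i i' j j' assume *: "i < k" "i' < k" "j < n" "j' < n" "i \<noteq> i'" "j \<noteq> j'"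
    show "\<not> ((i, j) \<in> U \<and> (i, j') \<in> U \<and> (i', j) \<notin> U \<and> (i', j') \<notin> U) \<and>
        \<not> ((i, j) \<in> U \<and> (i', j) \<in> U \<and> (i, j') \<notin> U \<and> (i', j') \<notin> U)"
      using av[unfolded line_avoiding_def, rule_format, of i' i j j']
        av[unfolded line_avoiding_def, rule_format, of i i' j' j] *
        that(2)[of i j] that(2)[of i j'] that(2)[of i' j] that(2)[of i' j'] by blast
  qed
  show ?thesis
    by (rule iffI; erule flip) auto
qed

lemma rook_position_line_avoiding:
  assumes "S \<in> rook_positions k n"
  shows "line_avoiding k n S"
  unfolding line_avoiding_def using assms[unfolded rook_positions_iff] by blast

text \<open>A single row that is empty in two columns already decides between the two kinds of avoiding
  sets. The bound on a column is carried from one column to the next by comparing them, and the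
  third row is what makes the comparison succeed.\<close>

lemma rook_position_of_empty_pair:
  assumes av: "line_avoiding k n S" and S: "S \<subseteq> {..<k} \<times> {..<n}" and "k \<ge> 3"
    and e: "r < k" "a < n" "b < n" "a \<noteq> b" "(r, a) \<notin> S" "(r, b) \<notin> S"
  shows "S \<in> rook_positions k n"
proof -
  note av' = av[unfolded line_avoiding_def, rule_format]
  have third: "\<exists>t<k. t \<noteq> i \<and> t \<noteq> i'" for i i'
  proof -
    have "\<not> {..<k} \<subseteq> {i, i'}"
      using \<open>k \<ge> 3\<close> card_mono[of "{i, i'}" "{..<k}"] by (auto simp: card_insert_if split: if_splits)
    then show ?thesis by auto
  qed
  \<comment> \<open>The empty row \<open>t\<close> forbids a row that is full in \<open>j\<close> and \<open>j'\<close>; so two ones in column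
    \<open>j\<close> would face two zeros in column \<open>j'\<close>.\<close>
  have col: "i = i'" if "(i, j) \<in> S" "(i', j) \<in> S"
    and empty: "t < k" "j' < n" "j \<noteq> j'" "(t, j) \<notin> S" "(t, j') \<notin> S" for i i' j t j'
  proof (rule ccontr)
    assume ne: "i \<noteq> i'"
    have b: "i < k" "i' < k" "j < n" using that S by auto
    have "(i, j') \<notin> S" if "(i, j) \<in> S" "i < k" for i
      using av'[of i t j j'] that empty b by auto
    then show False
      using av'[of i i' j j'] that b ne by auto
  qed
  have cola: "i = i'" if "(i, a) \<in> S" "(i', a) \<in> S" for i i'
    using col[of i a i' r b] that e by auto
  have colall: "i = i'" if ij: "(i, j) \<in> S" "(i', j) \<in> S" for i i' j
  proof (rule ccontr)
    assume ne: "i \<noteq> i'"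
    have b: "i < k" "i' < k" "j < n" using ij S by auto
    have "j \<noteq> a" using cola ij ne by auto
    obtain t where t: "t < k" "t \<noteq> i" "t \<noteq> i'" using third by blast
    show False
    \<comment> \<open>Column \<open>a\<close> holds at most one one. If no row is empty in both \<open>j\<close> and \<open>a\<close>, then at
      least two of the rows \<open>i, i', t\<close> have a one in \<open>j\<close> and a zero in \<open>a\<close>.\<close>
    proof (cases "\<exists>u<k. (u, j) \<notin> S \<and> (u, a) \<notin> S")
      case True
      then obtain u where "u < k" "(u, j) \<notin> S" "(u, a) \<notin> S" by blast
      then show False
        using col[of i j i' u a] ij ne e \<open>j \<noteq> a\<close> by auto
    next
      case False
      then have F: "(u, j) \<in> S \<or> (u, a) \<in> S" if "u < k" for u
        using that by auto
      have out: "\<not> ((u, j) \<in> S \<and> (v, j) \<in> S \<and> (u, a) \<notin> S \<and> (v, a) \<notin> S)" if "u < k" "v < k" "u \<noteq> v" for u v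
        using av'[of u v j a] that b e \<open>j \<noteq> a\<close> by auto
      show False
        using out[of i i'] out[of i t] out[of i' t] F[of i] F[of i'] F[of t] cola t b ne
        by metis
    qed
  qed
  moreover have "j = j'" if ij: "(i, j) \<in> S" "(i, j') \<in> S" for i j j'
  proof (rule ccontr)
    assume ne: "j \<noteq> j'"
    have b: "i < k" "j < n" "j' < n" using ij S by auto
    obtain t where t: "t < k" "t \<noteq> i" using third by blast
    then have "(t, j) \<notin> S" "(t, j') \<notin> S"
      using colall ij by blast+
    then show False
      using av'[of i t j j'] ij t b ne by auto
  qed
  ultimately show ?thesis
    using S unfolding rook_positions_iff by blast
qed

lemma line_avoiding_iff:
  assumes S: "S \<subseteq> {..<k} \<times> {..<n}" and "k \<ge> 3" "n \<ge> 2"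
  shows "line_avoiding k n S \<longleftrightarrow>
    S \<in> rook_positions k n \<or> {..<k} \<times> {..<n} - S \<in> rook_positions k n"
proof
  assume av: "line_avoiding k n S"
  have "\<exists>r<3. ((r, 0) \<in> S \<longleftrightarrow> (r, 1) \<in> S)"
  proof (rule ccontr)
    assume "\<not> ?thesis"
    then have m: "(r, 0) \<in> S \<longleftrightarrow> (r, 1) \<notin> S" if "r < 3" for r
      using that by auto
    have d: "((r, 0) \<in> S) \<noteq> ((r', 0) \<in> S)" if "r < 3" "r' < 3" "r \<noteq> r'" for r r'
      using av[unfolded line_avoiding_def, rule_format, of r r' 0 1]
        av[unfolded line_avoiding_def, rule_format, of r r' 1 0]
        m[of r] m[of r'] that assms by auto
    show False
      using d[of 0 1] d[of 0 2] d[of 1 2] by auto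
  qed
  then obtain r where r: "r < k" "(r, 0) \<in> S \<longleftrightarrow> (r, 1) \<in> S"
    using \<open>k \<ge> 3\<close> by (meson less_le_trans)
  show "S \<in> rook_positions k n \<or> {..<k} \<times> {..<n} - S \<in> rook_positions k n"
  proof (cases "(r, 0) \<in> S")
    case True
    then show ?thesis
      using rook_position_of_empty_pair[of k n "{..<k} \<times> {..<n} - S" r 0 1] av r assms
      by (simp add: line_avoiding_complement)
  next
    case False
    then show ?thesis
      using rook_position_of_empty_pair[of k n S r 0 1] av r assms by simp
  qed
next
  assume "S \<in> rook_positions k n \<or> {..<k} \<times> {..<n} - S \<in> rook_positions k n"
  then show "line_avoiding k n S"
    using rook_position_line_avoiding[of _ k n] line_avoiding_complement[of k n S] by metis
qed

lemma finite_rook_positions: "finite (rook_positions k n)"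
  by (rule finite_subset[of _ "Pow ({..<k} \<times> {..<n})"]) (auto simp: rook_positions_def)

text \<open>A rook position whose complement is one too would leave room for at most two cells in each
  column of the board; so the two families are disjoint.\<close>

lemma card_line_avoiding:
  assumes "k \<ge> 3" "n \<ge> 2"
  shows "card {S. S \<subseteq> {..<k} \<times> {..<n} \<and> line_avoiding k n S} = 2 * card (rook_positions k n)"
proof -
  let ?C = "{..<k} \<times> {..<n}" and ?R = "rook_positions k n"
  have sub: "S \<subseteq> ?C" if "S \<in> ?R" for S
    using that by (simp add: rook_positions_def)
  have "{S. S \<subseteq> ?C \<and> line_avoiding k n S} = ?R \<union> (\<lambda>S. ?C - S) ` ?R"
  proof (intro equalityI subsetI)
    fix S assume "S \<in> {S. S \<subseteq> ?C \<and> line_avoiding k n S}"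
    then have "S \<in> ?R \<or> ?C - S \<in> ?R" "S = ?C - (?C - S)"
      using line_avoiding_iff[OF _ assms] by auto
    then show "S \<in> ?R \<union> (\<lambda>S. ?C - S) ` ?R" by blast
  next
    fix S assume "S \<in> ?R \<union> (\<lambda>S. ?C - S) ` ?R"
    then show "S \<in> {S. S \<subseteq> ?C \<and> line_avoiding k n S}"
      using sub by (auto simp: rook_position_line_avoiding line_avoiding_complement)
  qed
  moreover have "?R \<inter> (\<lambda>S. ?C - S) ` ?R = {}"
  proof (rule ccontr)
    assume "\<not> ?thesis"
    then obtain S where S: "S \<in> ?R" "?C - S \<in> ?R" by auto
    have one: "\<not> ((i, 0) \<in> X \<and> (i', 0) \<in> X)" if "X \<in> ?R" "i \<noteq> i'" for X i i'
      using that unfolding rook_positions_iff by blast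
    have "\<not> ((i, 0) \<in> S \<longleftrightarrow> (i', 0) \<in> S)" if "i < 3" "i' < 3" "i \<noteq> i'" for i i'
      using one[OF S(1) that(3)] one[OF S(2) that(3)] that assms by auto
    from this[of 0 1] this[of 0 2] this[of 1 2] show False by auto
  qed
  moreover have "inj_on (\<lambda>S. ?C - S) ?R"
    using sub by (intro inj_onI) blast
  ultimately show ?thesis
    by (simp add: card_Un_disjoint finite_rook_positions card_image)
qed

section \<open>Counting rook positions\<close>

text \<open>Classify the positions with \<open>Suc l\<close> rooks on \<open>Suc k\<close> rows by the last row: it is
  empty, or its rook stands in one of the \<open>n - l\<close> columns left free by the other \<open>l\<close> rooks. The
  product formula satisfies the same recursion, by Pascal's rule for \<open>k\<close> and
  \<open>(n choose l) * (n - l) = (n choose Suc l) * Suc l\<close>.\<close>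

lemma card_rook_positions_size:
  "card {R \<in> rook_positions k n. card R = m} = (k choose m) * (n choose m) * fact m"
proof (induction k arbitrary: m)
  case 0
  have "rook_positions 0 n = {{}}"
    by (auto simp: rook_positions_def)
  then show ?case by (cases m) (simp_all add: Collect_conv_if)
next
  case (Suc k)
  have fin: "finite R" if "R \<in> rook_positions k n" for k R
    using that by (auto simp: rook_positions_def intro: finite_subset[of _ "{..<k} \<times> {..<n}"])
  show ?case
  proof (cases m)
    case 0
    have "{R \<in> rook_positions (Suc k) n. card R = 0} = {{}}"
      using fin by (auto simp: rook_positions_def)
    then show ?thesis using 0 by simp
  next
    case (Suc l)
    let ?Q = "\<lambda>k m. {R \<in> rook_positions k n. card R = m}"
    let ?D = "SIGMA R : ?Q k l. {..<n} - snd ` R"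
    let ?f = "\<lambda>(R, j). insert (k, j) R"
    have notin: "(k, j) \<notin> R" if "R \<in> rook_positions k n" for R j
      using that by (auto simp: rook_positions_def)
    have split: "?Q (Suc k) (Suc l) = ?Q k (Suc l) \<union> ?f ` ?D"
    proof (intro equalityI subsetI)
      fix R assume "R \<in> ?Q (Suc k) (Suc l)"
      then have R: "R \<in> rook_positions (Suc k) n" and c: "card R = Suc l" by auto
      show "R \<in> ?Q k (Suc l) \<union> ?f ` ?D"
      proof (cases "\<exists>j. (k, j) \<in> R")
        case True
        then obtain j where j: "(k, j) \<in> R" by blast
        let ?R = "R - {(k, j)}"
        have "i < k \<and> j' < n" if "(i, j') \<in> ?R" for i j'
        proof -
          have "i < Suc k" "j' < n" "i = k \<Longrightarrow> j' = j"
            using R j that unfolding rook_positions_iff by auto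
          then show ?thesis using that by (auto simp: less_Suc_eq)
        qed
        then have "?R \<in> rook_positions k n"
          using R unfolding rook_positions_iff by (auto; blast)
        moreover have "card ?R = l" using c j by (simp add: card_Diff_singleton)
        moreover have "j \<in> {..<n} - snd ` ?R"
          using R j unfolding rook_positions_iff by auto
        ultimately have "(?R, j) \<in> ?D" by simp
        moreover have "R = ?f (?R, j)" using j by auto
        ultimately show ?thesis by blast
      next
        case False
        then have "i < k \<and> j' < n" if "(i, j') \<in> R" for i j'
        proof -
          have "i < Suc k" "j' < n" "i \<noteq> k"
            using R False that unfolding rook_positions_iff by auto
          then show ?thesis by simp
        qed
        then have "R \<subseteq> {..<k} \<times> {..<n}" by auto
        then have "R \<in> rook_positions k n"
          using R unfolding rook_positions_iff by blast
        then show ?thesis using c by simp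
      qed
    next
      fix R assume "R \<in> ?Q k (Suc l) \<union> ?f ` ?D"
      then show "R \<in> ?Q (Suc k) (Suc l)"
      proof
        assume "R \<in> ?Q k (Suc l)"
        moreover from this have "R \<subseteq> {..<Suc k} \<times> {..<n}"
          unfolding rook_positions_iff by (auto simp: less_Suc_eq)
        ultimately show ?thesis unfolding rook_positions_iff by blast
      next
        assume "R \<in> ?f ` ?D"
        then obtain R' j where R': "R' \<in> rook_positions k n" "card R' = l"
          and j: "j < n" "j \<notin> snd ` R'" and R: "R = insert (k, j) R'"
          by auto
        have "\<And>i. (i, j) \<notin> R'" using j by force
        moreover have "R \<subseteq> {..<Suc k} \<times> {..<n}"
          using R'(1) j unfolding R rook_positions_iff by (auto simp: less_Suc_eq)
        ultimately have "R \<in> rook_positions (Suc k) n"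
          using R'(1) notin[OF R'(1)] unfolding R rook_positions_iff by blast
        moreover have "card R = Suc l"
          using R' fin notin by (simp add: R)
        ultimately show ?thesis by simp
      qed
    qed
    have disj: "?Q k (Suc l) \<inter> ?f ` ?D = {}"
      using notin by auto
    have finQ: "finite (?Q k i)" for i
      using finite_rook_positions by simp
    have "inj_on ?f ?D"
    proof (rule inj_onI, clarsimp)
      fix R j R' j'
      assume "R \<in> rook_positions k n" "R' \<in> rook_positions k n"
        and eq: "insert (k, j) R = insert (k, j') R'"
      then have n: "(k, i) \<notin> R" "(k, i) \<notin> R'" for i using notin by auto
      have "(k, j) \<in> insert (k, j') R'" using eq by (metis insertI1)
      then have "j = j'" using n by simp
      then show "R = R' \<and> j = j'" using eq n by (simp add: insert_ident)
    qed
    then have "card (?f ` ?D) = card ?D"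
      by (rule card_image)
    also have "\<dots> = (\<Sum>R \<in> ?Q k l. card ({..<n} - snd ` R))"
      using finQ by (simp add: card_SigmaI)
    also have "\<dots> = (\<Sum>R \<in> ?Q k l. n - l)"
    proof (rule sum.cong)
      fix R assume "R \<in> ?Q k l"
      then have R: "R \<in> rook_positions k n" "card R = l" by auto
      have "inj_on snd R" using R unfolding rook_positions_iff by (auto simp: inj_on_def)
      moreover have "snd ` R \<subseteq> {..<n}" using R unfolding rook_positions_iff by auto
      ultimately show "card ({..<n} - snd ` R) = n - l"
        using R by (simp add: card_Diff_subset finite_subset card_image)
    qed simp
    also have "\<dots> = (k choose l) * ((n choose l) * (n - l)) * fact l"
      by (simp add: Suc.IH)
    also have "(n choose l) * (n - l) = (n choose Suc l) * Suc l"
      using binomial_absorb_comp[of n l] binomial_absorption[of l n] by (simp add: mult.commute)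
    finally have "card (?f ` ?D) = (k choose l) * (n choose Suc l) * fact (Suc l)"
      by (simp add: algebra_simps)
    moreover have "card (?Q (Suc k) (Suc l)) = card (?Q k (Suc l)) + card (?f ` ?D)"
      unfolding split using disj finQ
      by (intro card_Un_disjoint) (auto intro!: finite_imageI finite_SigmaI)
    ultimately show ?thesis
      by (simp add: \<open>m = Suc l\<close> Suc.IH algebra_simps)
  qed
qed

lemma card_rook_positions:
  "card (rook_positions k n) = (\<Sum>m = 0..min k n. (k choose m) * (n choose m) * fact m)"
proof -
  have "card R \<le> min k n" if R: "R \<in> rook_positions k n" for R
  proof -
    have "inj_on fst R" "inj_on snd R" "fst ` R \<subseteq> {..<k}" "snd ` R \<subseteq> {..<n}"
      using R unfolding rook_positions_iff by (auto simp: inj_on_def)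
    then show ?thesis
      by (metis card_inj_on_le card_lessThan finite_lessThan min.bounded_iff)
  qed
  then have "rook_positions k n = (\<Union>m \<in> {0..min k n}. {R \<in> rook_positions k n. card R = m})"
    by auto
  also have "card \<dots> = (\<Sum>m = 0..min k n. card {R \<in> rook_positions k n. card R = m})"
    by (rule card_UN_disjoint) (auto simp: finite_rook_positions)
  finally show ?thesis
    by (simp only: card_rook_positions_size)
qed

theorem theorem3p3:
  fixes k n :: nat
  assumes "k \<ge> 3" and "n \<ge> 2"
  shows "phi k n {T_mat, L_mat} = 2 * card (rook_positions k n)
    \<and> phi k n {T_mat, L_mat} = 2 * (\<Sum>m = 0..min k n. (k choose m) * (n choose m) * fact m)"
  using card_line_avoiding[OF assms] by (simp add: phi_eq_card_line_avoiding card_rook_positions)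

end
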